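(* Let $\mathcal{X}$ be a real Banach space and $J:\mathcal{X}\to(-\infty,+\infty]$ a convex, absolutely one-homogeneous functional with $\{u\in\mathcal{X}:J(u)=0\}=\{0\}$. Let $R(u)=J(u)/\|u\|_{\mathcal{X}}$ for $u\in\mathcal{X}\setminus\{0\}$ and $R_*(\mu)=\|\mu\|_{\mathcal{X}^*}/J_*(\mu)$ for $\mu\in\mathcal{X}^*\setminus\{0\}$. Then $$\inf_{u\in\mathcal{X}\setminus\{0\}}R(u)\le\inf_{\mu\in\mathcal{X}^*\setminus\{0\}}R_*(\mu),$$ with equality if the left problem admits a minimizer. If furthermore $u\in\mathcal{X}\setminus\{0\}$ satisfies $\lambda\Phi_{\mathcal{X}}(u)\cap\partial J(u)\neq\emptyset$ with $\lambda=\lambda_{\min}:=\inf_{v\in\mathcal{X}\setminus\{0\}}R(v)$, then any $\mu\in\Phi_{\mathcal{X}}(u)$ with $\lambda_{\min}\mu\in\partial J(u)$ satisfies $$\lambda\,\partial J_*(\mu)\cap\Phi_{\mathcal{X}^*}(\mu)\neq\emptyset\quad\text{with }\lambda=\lambda_{\min}.$$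
   Context: $J$ is absolutely one-homogeneous if $J(cu)=|c|J(u)$ for all $c\in\mathbb{R}$ and all $u$ in the domain $\mathrm{dom}(J)=\{J<\infty\}$. $J$ is understood to be non-trivial, i.e. $\mathrm{dom}(J)\ne\{0\}$. $\mathcal{X}^*$ is the topological dual with the dual norm $\|\mu\|_{\mathcal{X}^*}=\sup_{\|u\|_{\mathcal{X}}=1}\langle\mu,u\rangle$. The subdifferential of a convex functional $F$ on a Banach space $\mathcal{Y}$ is $\partial F(y)=\{\eta\in\mathcal{Y}^*:F(y)+\langle\eta,z-y\rangle\le F(z)\ \forall z\in\mathcal{Y}\}$. The duality map of $\mathcal{Y}$ is $\Phi_{\mathcal{Y}}(y)=\{\eta\in\mathcal{Y}^*:\|\eta\|_{\mathcal{Y}^*}\le1,\ \langle\eta,y\rangle=\|y\|_{\mathcal{Y}}\}$. The dual functional is $J_*(\mu)=\sup\{\langle\mu,u\rangle:u\in\mathcal{X},\ J(u)=1\}$ for $\mu\in\mathcal{X}^*$. Thus $\partial J_*(\mu)$ and $\Phi_{\mathcal{X}^*}(\mu)$ are subsets of the bidual $\mathcal{X}^{**}$. Convention: $R_*(\mu)=+\infty$ if $J_*(\mu)=0$ and $R_*(\mu)=0$ if $J_*(\mu)=+\infty$ (for $\mu\ne0$). *)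

theory Defs
  imports "HOL-Analysis.Analysis"
begin

text \<open>
  The topological dual of \<open>'a\<close> is the normed space \<open>'a \<Rightarrow>\<^sub>L real\<close>, the bidual is
  \<open>('a \<Rightarrow>\<^sub>L real) \<Rightarrow>\<^sub>L real\<close>; the dual norms are the operator norms of the library.
  Functionals with values in \<open>(-\<infinity>, \<infinity>]\<close> are \<open>ereal\<close>-valued functions that
  never take the value \<open>-\<infinity>\<close>.
\<close>

lemma dual_norm_eq_SUP_sphere:
  fixes \<mu> :: "'a::real_normed_vector \<Rightarrow>\<^sub>L real"
  assumes "(UNIV::'a set) \<noteq> {0}"
  shows "norm \<mu> = (SUP u\<in>{u. norm u = 1}. blinfun_apply \<mu> u)"
proof -
  let ?S = "{u::'a. norm u = 1}"
  obtain w :: 'a where "w \<noteq> 0" using assms by blast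
  then have ne: "sgn w \<in> ?S" by (simp add: norm_sgn)
  have ub: "blinfun_apply \<mu> u \<le> norm \<mu>" if "u \<in> ?S" for u
    using norm_blinfun[of \<mu> u] that by simp
  have bdd: "bdd_above (blinfun_apply \<mu> ` ?S)"
    using ub by (intro bdd_aboveI2)
  let ?s = "SUP u\<in>?S. blinfun_apply \<mu> u"
  have le: "blinfun_apply \<mu> u \<le> ?s * norm u" for u
  proof (cases "u = 0")
    case False
    then have "blinfun_apply \<mu> (sgn u) \<le> ?s"
      by (intro cSUP_upper bdd) (simp add: norm_sgn)
    then show ?thesis using False
      by (simp add: sgn_div_norm blinfun.scaleR_right field_simps)
  qed simp
  have abs_le: "norm (blinfun_apply \<mu> u) \<le> ?s * norm u" for u
    using le[of u] le[of "- u"] by (simp add: blinfun.minus_right)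
  have "0 \<le> ?s"
    using order_trans[OF norm_ge_zero abs_le[of "sgn w"]] ne by simp
  then have "norm \<mu> \<le> ?s" by (intro norm_blinfun_bound abs_le)
  moreover have "?s \<le> norm \<mu>" using ne ub by (intro cSUP_least) auto
  ultimately show ?thesis by simp
qed

definition effective_domain :: "('a \<Rightarrow> ereal) \<Rightarrow> 'a set"
  where "effective_domain F = {u. F u < \<infinity>}"

text \<open>For functions avoiding \<open>-\<infinity>\<close> the right-hand side is never of the form
  \<open>\<infinity> - \<infinity>\<close>; the endpoints are harmless because \<open>0 * \<infinity> = 0\<close> in \<open>ereal\<close>.\<close>

definition convex_functional :: "('a::real_vector \<Rightarrow> ereal) \<Rightarrow> bool"
  where "convex_functional F \<longleftrightarrow>
    (\<forall>u v. \<forall>t\<in>{0..1::real}.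
       F ((1 - t) *\<^sub>R u + t *\<^sub>R v) \<le> ereal (1 - t) * F u + ereal t * F v)"

definition abs_one_homogeneous :: "('a::real_vector \<Rightarrow> ereal) \<Rightarrow> bool"
  where "abs_one_homogeneous F \<longleftrightarrow>
    (\<forall>c::real. \<forall>u\<in>effective_domain F. F (c *\<^sub>R u) = ereal \<bar>c\<bar> * F u)"

definition subdifferential ::
    "('a::real_normed_vector \<Rightarrow> ereal) \<Rightarrow> 'a \<Rightarrow> ('a \<Rightarrow>\<^sub>L real) set"
  where "subdifferential F y = {\<eta>. \<forall>z. F y + ereal (blinfun_apply \<eta> (z - y)) \<le> F z}"

definition duality_map :: "'a::real_normed_vector \<Rightarrow> ('a \<Rightarrow>\<^sub>L real) set"
  where "duality_map y = {\<eta>. norm \<eta> \<le> 1 \<and> blinfun_apply \<eta> y = norm y}"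

definition dual_functional ::
    "('a::real_normed_vector \<Rightarrow> ereal) \<Rightarrow> ('a \<Rightarrow>\<^sub>L real) \<Rightarrow> ereal"
  where "dual_functional J \<mu> = (SUP u\<in>{u. J u = 1}. ereal (blinfun_apply \<mu> u))"

definition rayleigh :: "('a::real_normed_vector \<Rightarrow> ereal) \<Rightarrow> 'a \<Rightarrow> ereal"
  where "rayleigh J u = J u / ereal (norm u)"

text \<open>Division in \<open>ereal\<close> implements the conventions for a vanishing or infinite
  denominator, see the two lemmas below.\<close>

definition dual_rayleigh ::
    "('a::real_normed_vector \<Rightarrow> ereal) \<Rightarrow> ('a \<Rightarrow>\<^sub>L real) \<Rightarrow> ereal"
  where "dual_rayleigh J \<mu> = ereal (norm \<mu>) / dual_functional J \<mu>"

lemma dual_rayleigh_zero_denominator: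
  "\<mu> \<noteq> 0 \<Longrightarrow> dual_functional J \<mu> = 0 \<Longrightarrow> dual_rayleigh J \<mu> = \<infinity>"
  by (simp add: dual_rayleigh_def divide_ereal_def)

lemma dual_rayleigh_infinite_denominator:
  "dual_functional J \<mu> = \<infinity> \<Longrightarrow> dual_rayleigh J \<mu> = 0"
  by (simp add: dual_rayleigh_def)

text \<open>Under the standing assumptions the infimum of the Rayleigh quotient is a real number,
  so a real scalar \<open>l\<close> with \<open>ereal l = (INF v\<in>UNIV - {0}. rayleigh J v)\<close> exists and is unique.\<close>

lemma inf_rayleigh_real:
  fixes J :: "'a::real_normed_vector \<Rightarrow> ereal"
  assumes "\<And>u. J u \<noteq> -\<infinity>"
    and "convex_functional J"
    and "abs_one_homogeneous J"
    and "effective_domain J \<noteq> {0}"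
    and "{u. J u = 0} = {0}"
  shows "\<exists>!l::real. ereal l = (INF v\<in>UNIV - {0}. rayleigh J v)"
proof -
  have J0: "J 0 = 0" using assms(5) by blast
  have nonneg: "0 \<le> J u" for u
  proof (cases "J u = \<infinity>")
    case False
    then obtain r where r: "J u = ereal r" using assms(1)[of u] by (cases "J u") auto
    then have "J (- u) = ereal r"
      using assms(3) unfolding abs_one_homogeneous_def effective_domain_def
      by (auto dest!: spec[of _ "-1"] bspec[of _ _ u])
    moreover have "J ((1 - 1/2) *\<^sub>R u + (1/2) *\<^sub>R (- u))
        \<le> ereal (1 - 1/2) * J u + ereal (1/2) * J (- u)"
      using assms(2) unfolding convex_functional_def
      by (elim allE[of _ u] allE[of _ "- u"] ballE[of _ _ "1/2"]) auto
    ultimately show ?thesis using r J0 by simp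
  qed auto
  from assms(4) J0 obtain v where v: "v \<noteq> 0" "J v < \<infinity>"
    unfolding effective_domain_def by fastforce
  then obtain r where r: "J v = ereal r" using assms(1)[of v] by (cases "J v") auto
  have "(INF v\<in>UNIV - {0}. rayleigh J v) \<le> rayleigh J v"
    using v by (intro INF_lower) auto
  also have "\<dots> < \<infinity>" using r v by (simp add: rayleigh_def)
  finally have 1: "(INF v\<in>UNIV - {0}. rayleigh J v) < \<infinity>" .
  have "0 \<le> (INF v\<in>UNIV - {0}. rayleigh J v)"
    unfolding rayleigh_def
    by (intro INF_greatest) (auto simp: nonneg zero_le_divide_ereal)
  with 1 obtain s where "(INF v\<in>UNIV - {0}. rayleigh J v) = ereal s" by (cases "INF v\<in>UNIV - {0}. rayleigh J v") auto
  then show ?thesis by auto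
qed

end

theory Submission
  imports Defs
begin

text \<open>
  Let \<open>\<lambda>\<close> be the infimum of \<open>J u / \<parallel>u\<parallel>\<close>, so that \<open>\<lambda> \<parallel>u\<parallel> \<le> J u\<close> for every \<open>u\<close>. If \<open>J u = 1\<close>, then
  \<open>\<lambda> \<langle>\<mu>, u\<rangle> \<le> \<lambda> \<parallel>u\<parallel> \<parallel>\<mu>\<parallel> \<le> \<parallel>\<mu>\<parallel>\<close>, and the supremum over such \<open>u\<close> gives
  \<open>\<lambda> J\<^sub>*(\<mu>) \<le> \<parallel>\<mu>\<parallel>\<close>: this is the inequality between the two infima.

  The other direction rests on one computation (\<open>dual_functional_at_minimizer\<close>). If \<open>u\<close>
  attains \<open>\<lambda>\<close> and \<open>\<mu>\<close> is a norming functional of \<open>u\<close>, then \<open>w = u / J u\<close> satisfies \<open>J w = 1\<close>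
  and \<open>\<langle>\<mu>, w\<rangle> = \<parallel>u\<parallel> / J u = 1 / \<lambda>\<close>, so that \<open>w\<close> realises the upper bound \<open>J\<^sub>*(\<mu>) \<le> 1 / \<lambda>\<close>
  and the dual quotient of \<open>\<mu>\<close> is \<open>\<lambda>\<close>; here \<open>\<lambda> > 0\<close>, because \<open>J\<close> vanishes only at \<open>0\<close>. A norming
  functional exists by the Hahn-Banach theorem (\<open>duality_map_nonempty\<close>), and equality of the
  infima follows.

  The Hahn-Banach theorem enters through Zorn's lemma for sublinear functionals: below each of
  them there is a minimal one, and a minimal one is linear, since otherwise it could be lowered
  along some direction \<open>y\<close>. The same lowering, applied to the norm along \<open>u\<close>, is what makes the
  resulting linear functional norming for \<open>u\<close>.

  The last assertion uses the same point \<open>w\<close>. A one-homogeneous \<open>J\<close> satisfies Euler's identity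
  \<open>J u = \<langle>p, u\<rangle>\<close> for \<open>p \<in> \<partial>J(u)\<close>; hence \<open>\<lambda> \<mu> \<in> \<partial>J(u)\<close> with \<open>\<mu>\<close> norming for \<open>u\<close>
  makes \<open>u\<close> a minimizer. As \<open>J\<^sub>*\<close> is a supremum of linear functionals, among them the evaluation at
  \<open>w\<close>, and as this one attains the supremum at \<open>\<mu>\<close>, the evaluation at \<open>w\<close> is a subgradient of \<open>J\<^sub>*\<close>
  at \<open>\<mu>\<close>. Multiplied by \<open>\<lambda>\<close> it is the evaluation at \<open>u / \<parallel>u\<parallel>\<close>, a norming element for \<open>\<mu>\<close>.
\<close>

section \<open>Linear functionals below a sublinear one\<close>

definition sublinear :: "('a::real_vector \<Rightarrow> real) \<Rightarrow> bool"
  where "sublinear q \<longleftrightarrow>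
    (\<forall>x y. q (x + y) \<le> q x + q y) \<and> (\<forall>c\<ge>0. \<forall>x. q (c *\<^sub>R x) = c * q x)"

lemma sublinearI:
  assumes "\<And>x y. q (x + y) \<le> q x + q y"
    and "q 0 = 0"
    and le: "\<And>c x. 0 < c \<Longrightarrow> q (c *\<^sub>R x) \<le> c * q x"
  shows "sublinear q"
proof -
  have "q (c *\<^sub>R x) = c * q x" if "0 < c" for c x
  proof (rule antisym)
    have "q ((1 / c) *\<^sub>R (c *\<^sub>R x)) \<le> (1 / c) * q (c *\<^sub>R x)"
      using that by (intro le) simp
    then show "c * q x \<le> q (c *\<^sub>R x)" using that by (simp add: field_simps)
  qed (rule le[OF that])
  then have "q (c *\<^sub>R x) = c * q x" if "0 \<le> c" for c x
    using that assms(2) by (cases "c = 0") auto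
  with assms(1) show ?thesis unfolding sublinear_def by blast
qed

lemma sublinear_add: "sublinear q \<Longrightarrow> q (x + y) \<le> q x + q y"
  by (simp add: sublinear_def)

lemma sublinear_scaleR: "sublinear q \<Longrightarrow> 0 \<le> c \<Longrightarrow> q (c *\<^sub>R x) = c * q x"
  by (simp add: sublinear_def)

lemma sublinear_zero: "sublinear q \<Longrightarrow> q 0 = 0"
  using sublinear_scaleR[of q 0 0] by simp

lemma sublinear_ge_minus: "sublinear q \<Longrightarrow> - q (- x) \<le> q x"
  using sublinear_add[of q x "- x"] by (simp add: sublinear_zero)

text \<open>The largest sublinear functional below \<open>q\<close> that takes at \<open>- y\<close> the smallest possible value,
  \<open>- q y\<close>. It forces linearity along \<open>y\<close> without changing the value at \<open>y\<close>.\<close>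

definition flatten :: "('a::real_vector \<Rightarrow> real) \<Rightarrow> 'a \<Rightarrow> 'a \<Rightarrow> real"
  where "flatten q y x = (INF t\<in>{0..}. q (x + t *\<^sub>R y) - t * q y)"

lemma flatten_lower:
  assumes "sublinear q" and "0 \<le> t"
  shows "flatten q y x \<le> q (x + t *\<^sub>R y) - t * q y"
  unfolding flatten_def
proof (rule cINF_lower)
  have "- q (- x) \<le> q (x + s *\<^sub>R y) - s * q y" if "0 \<le> s" for s
    using sublinear_add[OF assms(1), of "x + s *\<^sub>R y" "- x"]
      sublinear_scaleR[OF assms(1) that, of y] by simp
  then show "bdd_below ((\<lambda>t. q (x + t *\<^sub>R y) - t * q y) ` {0..})"
    by (intro bdd_belowI2) auto
qed (use assms in simp)

lemma flatten_greatest: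
  assumes "\<And>t. 0 \<le> t \<Longrightarrow> m \<le> q (x + t *\<^sub>R y) - t * q y"
  shows "m \<le> flatten q y x"
  unfolding flatten_def using assms by (intro cINF_greatest) auto

lemma flatten_le: "sublinear q \<Longrightarrow> flatten q y x \<le> q x"
  using flatten_lower[of q 0 y x] by simp

lemma flatten_minus: "sublinear q \<Longrightarrow> flatten q y (- y) \<le> - q y"
  using flatten_lower[of q 1 y "- y"] by (simp add: sublinear_zero)

lemma sublinear_flatten:
  assumes q: "sublinear q"
  shows "sublinear (flatten q y)"
proof (rule sublinearI)
  fix x x' :: 'a
  have "flatten q y (x + x') \<le> (q (x + s *\<^sub>R y) - s * q y) + (q (x' + t *\<^sub>R y) - t * q y)"
    if "0 \<le> s" "0 \<le> t" for s t
    using flatten_lower[OF q, of "s + t" y "x + x'"] that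
      sublinear_add[OF q, of "x + s *\<^sub>R y" "x' + t *\<^sub>R y"]
    by (simp add: algebra_simps)
  then have "flatten q y (x + x') - (q (x + s *\<^sub>R y) - s * q y) \<le> flatten q y x'"
    if "0 \<le> s" for s
    using that by (intro flatten_greatest) (simp add: diff_le_eq add.commute)
  then have "flatten q y (x + x') - flatten q y x' \<le> flatten q y x"
    by (intro flatten_greatest) (simp add: algebra_simps)
  then show "flatten q y (x + x') \<le> flatten q y x + flatten q y x'" by simp
next
  have "0 \<le> flatten q y 0"
    by (intro flatten_greatest) (simp add: sublinear_scaleR[OF q])
  then show "flatten q y 0 = 0"
    using flatten_le[OF q, of y 0] by (simp add: sublinear_zero[OF q])
next
  fix c :: real and x :: 'a
  assume c: "0 < c"
  have "flatten q y (c *\<^sub>R x) / c \<le> flatten q y x"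
  proof (rule flatten_greatest)
    fix t :: real
    assume "0 \<le> t"
    then have "flatten q y (c *\<^sub>R x) \<le> q (c *\<^sub>R (x + t *\<^sub>R y)) - (c * t) * q y"
      using flatten_lower[OF q, of "c * t" y "c *\<^sub>R x"] c by (simp add: scaleR_add_right)
    also have "\<dots> = (q (x + t *\<^sub>R y) - t * q y) * c"
      using c by (simp add: sublinear_scaleR[OF q] left_diff_distrib)
    finally show "flatten q y (c *\<^sub>R x) / c \<le> q (x + t *\<^sub>R y) - t * q y"
      using c by (simp add: pos_divide_le_eq)
  qed
  then show "flatten q y (c *\<^sub>R x) \<le> c * flatten q y x" using c by (simp add: field_simps)
qed

text \<open>Flattening in a direction \<open>y\<close> cannot lower a minimal \<open>q\<close>, so \<open>q (- y) \<le> - q y\<close> for every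
  \<open>y\<close>; an odd sublinear functional is linear.\<close>

lemma minimal_sublinear_imp_linear:
  assumes q: "sublinear q"
    and min: "\<And>r. sublinear r \<Longrightarrow> r \<le> q \<Longrightarrow> r = q"
  shows "linear q"
proof -
  have neg: "q (- y) = - q y" for y
  proof -
    have "flatten q y = q"
      by (intro min sublinear_flatten q) (simp add: le_fun_def flatten_le[OF q])
    then show ?thesis
      using flatten_minus[OF q, of y] sublinear_ge_minus[OF q, of "- y"] by simp
  qed
  show ?thesis
  proof (rule linearI)
    fix x y :: 'a
    show "q (x + y) = q x + q y"
      using sublinear_add[OF q, of x y] sublinear_add[OF q, of "- x" "- y"] neg[of "x + y"]
      by (simp add: neg)
  next
    fix c :: real and x :: 'a
    show "q (c *\<^sub>R x) = c *\<^sub>R q x"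
    proof (cases "0 \<le> c")
      case False
      then show ?thesis
        using neg[of "(- c) *\<^sub>R x"] sublinear_scaleR[OF q, of "- c" x] by simp
    qed (simp add: sublinear_scaleR[OF q])
  qed
qed

text \<open>The bound \<open>- p (- x) \<le> q x\<close>, common to all sublinear \<open>q \<le> p\<close>, keeps the pointwise infimum
  of a chain finite.\<close>

lemma sublinear_INF_chain:
  assumes ne: "C \<noteq> {}"
    and sub: "\<And>q. q \<in> C \<Longrightarrow> sublinear q"
    and le: "\<And>q. q \<in> C \<Longrightarrow> q \<le> p"
    and chain: "\<And>q r. q \<in> C \<Longrightarrow> r \<in> C \<Longrightarrow> q \<le> r \<or> r \<le> q"
  shows "sublinear (\<lambda>x. INF q\<in>C. q x)" (is "sublinear ?g")
    and "q \<in> C \<Longrightarrow> (\<lambda>x. INF q\<in>C. q x) \<le> q"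
proof -
  have lower: "?g x \<le> q x" if "q \<in> C" for q x
  proof (rule cINF_lower[OF _ that])
    have "- p (- x) \<le> r x" if "r \<in> C" for r
      using sublinear_ge_minus[OF sub[OF that], of x] le_funD[OF le[OF that], of "- x"] by simp
    then show "bdd_below ((\<lambda>q. q x) ` C)" by (intro bdd_belowI2)
  qed
  show "?g \<le> q" if "q \<in> C" for q
    using lower[OF that] by (simp add: le_fun_def)
  show "sublinear ?g"
  proof (rule sublinearI)
    fix x y :: 'a
    have "?g (x + y) \<le> r y + q x" if "q \<in> C" "r \<in> C" for q r
      using chain[OF that]
    proof
      assume "q \<le> r"
      then show ?thesis
        using lower[OF that(1), of "x + y"] sublinear_add[OF sub[OF that(1)], of x y]
          le_funD[of q r y] by simp
    next
      assume "r \<le> q"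
      then show ?thesis
        using lower[OF that(2), of "x + y"] sublinear_add[OF sub[OF that(2)], of x y]
          le_funD[of r q x] by simp
    qed
    then have "?g (x + y) - q x \<le> ?g y" if "q \<in> C" for q
      using that by (intro cINF_greatest[OF ne]) (simp add: diff_le_eq)
    then have "?g (x + y) - ?g y \<le> ?g x"
      by (intro cINF_greatest[OF ne]) (simp add: algebra_simps)
    then show "?g (x + y) \<le> ?g x + ?g y" by simp
  next
    show "?g 0 = 0" using ne by (simp add: sub sublinear_zero cong: INF_cong)
  next
    fix c :: real and x :: 'a
    assume c: "0 < c"
    have "?g (c *\<^sub>R x) / c \<le> ?g x"
    proof (rule cINF_greatest[OF ne])
      fix q assume "q \<in> C"
      then show "?g (c *\<^sub>R x) / c \<le> q x"
        using lower[of q "c *\<^sub>R x"] sublinear_scaleR[OF sub, of q c x] c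
        by (simp add: field_simps)
    qed
    then show "?g (c *\<^sub>R x) \<le> c * ?g x" using c by (simp add: field_simps)
  qed
qed

theorem ex_linear_le_sublinear:
  assumes p: "sublinear p"
  shows "\<exists>f. linear f \<and> f \<le> p"
proof -
  let ?A = "{q. sublinear q \<and> q \<le> p}"
  have "\<exists>m\<in>?A. \<forall>q\<in>?A. q \<le> m \<longrightarrow> q = m"
  proof (rule predicate_Zorn)
    show "partial_order_on ?A (relation_of (\<lambda>q r. r \<le> q) ?A)"
      by (rule partial_order_on_relation_ofI) auto
  next
    fix C
    assume C: "C \<in> Chains (relation_of (\<lambda>q r. r \<le> q) ?A)"
    then have sub: "\<And>q. q \<in> C \<Longrightarrow> sublinear q" and le: "\<And>q. q \<in> C \<Longrightarrow> q \<le> p"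
      using Chains_relation_of[OF C] by auto
    have chain: "\<And>q r. q \<in> C \<Longrightarrow> r \<in> C \<Longrightarrow> q \<le> r \<or> r \<le> q"
      using C unfolding Chains_def relation_of_def by blast
    show "\<exists>u\<in>?A. \<forall>a\<in>C. u \<le> a"
    proof (cases "C = {}")
      case True
      then show ?thesis using p by auto
    next
      case False
      note inf = sublinear_INF_chain[OF False sub le chain]
      from False obtain q where "q \<in> C" by blast
      then have "(\<lambda>x. INF q\<in>C. q x) \<le> p"
        using inf(2) le order_trans by blast
      with inf show ?thesis by (intro bexI[of _ "\<lambda>x. INF q\<in>C. q x"]) auto
    qed
  qed
  then obtain m where "sublinear m" and "m \<le> p"
    and min: "\<And>q. sublinear q \<Longrightarrow> q \<le> p \<Longrightarrow> q \<le> m \<Longrightarrow> q = m" by blast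
  then have "linear m"
    by (intro minimal_sublinear_imp_linear min) (auto intro: order_trans)
  with \<open>m \<le> p\<close> show ?thesis by blast
qed

text \<open>Flattening the norm in the direction \<open>u\<close> gives a sublinear functional with the value
  \<open>- \<parallel>u\<parallel>\<close> at \<open>- u\<close>; a linear functional below it has norm at most \<open>1\<close> and must take the
  value \<open>\<parallel>u\<parallel>\<close> at \<open>u\<close>.\<close>

theorem duality_map_nonempty: "duality_map u \<noteq> {}"
proof -
  have norm: "sublinear (norm :: 'a \<Rightarrow> real)"
    by (rule sublinearI) (auto simp: norm_triangle_ineq)
  obtain f where f: "linear f" and le: "f \<le> flatten norm u"
    using ex_linear_le_sublinear[OF sublinear_flatten[OF norm]] by blast
  have le_norm: "f x \<le> norm x" for x
    using le_funD[OF le, of x] flatten_le[OF norm, of u x] by simp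
  have bound: "\<bar>f x\<bar> \<le> norm x" for x
    using le_norm[of x] le_norm[of "- x"] linear_neg[OF f, of x] by simp
  have "bounded_linear f"
    using f bound by (intro bounded_linear_intro[of f 1]) (auto simp: linear_add linear_cmul)
  then have app: "blinfun_apply (Blinfun f) = f" by (rule bounded_linear_Blinfun_apply)
  have "f u = norm u"
    using le_funD[OF le, of "- u"] flatten_minus[OF norm, of u] le_norm[of u]
      linear_neg[OF f, of u] by simp
  moreover have "norm (Blinfun f) \<le> 1"
    using bound by (intro norm_blinfun_bound) (auto simp: app)
  ultimately have "Blinfun f \<in> duality_map u" by (simp add: duality_map_def app)
  then show ?thesis by blast
qed

lemma norm_eq_1_of_duality_map:
  assumes "u \<noteq> 0" and "\<mu> \<in> duality_map u"
  shows "norm \<mu> = 1"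
proof -
  have "norm \<mu> \<le> 1" and "norm u \<le> norm \<mu> * norm u"
    using assms norm_blinfun[of \<mu> u] by (auto simp: duality_map_def)
  then show ?thesis using assms(1) by simp
qed


section \<open>The Rayleigh quotient and its dual\<close>

lemma one_homogeneous_scaleR:
  assumes "abs_one_homogeneous J" and "J u = ereal r"
  shows "J (c *\<^sub>R u) = ereal (\<bar>c\<bar> * r)"
  using assms unfolding abs_one_homogeneous_def effective_domain_def by auto

text \<open>The midpoint of \<open>u\<close> and \<open>- u\<close> is \<open>0\<close>, and \<open>J\<close> takes the same value at both.\<close>

lemma convex_one_homogeneous_nonneg:
  assumes "J u \<noteq> -\<infinity>" and "convex_functional J" and "abs_one_homogeneous J" and "J 0 = 0"
  shows "0 \<le> J u"
proof (cases "J u")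
  case (real r)
  then have "J (- u) = ereal r"
    using one_homogeneous_scaleR[OF assms(3) real, of "-1"] by simp
  moreover have "J ((1 - 1/2) *\<^sub>R u + (1/2) *\<^sub>R (- u))
      \<le> ereal (1 - 1/2) * J u + ereal (1/2) * J (- u)"
    using assms(2) unfolding convex_functional_def
    by (elim allE[of _ u] allE[of _ "- u"] ballE[of _ _ "1/2"]) auto
  ultimately show ?thesis using real assms(4) by simp
qed (use assms in auto)

lemma ex_unit_value:
  assumes "\<And>u. 0 \<le> J u" and "abs_one_homogeneous J"
    and "effective_domain J \<noteq> {0}" and zero: "{u. J u = 0} = {0}"
  obtains v where "J v = 1"
proof -
  have "J 0 = 0" using zero by blast
  then have "0 \<in> effective_domain J" by (simp add: effective_domain_def)
  with assms(3) obtain w where "w \<noteq> 0" and "w \<in> effective_domain J" by blast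
  then have "J w < \<infinity>" by (simp add: effective_domain_def)
  moreover have "J w \<noteq> 0" using \<open>w \<noteq> 0\<close> zero by blast
  ultimately obtain r where r: "J w = ereal r" and "0 < r"
    using assms(1)[of w] by (cases "J w") auto
  then have "J ((1 / r) *\<^sub>R w) = 1"
    using one_homogeneous_scaleR[OF assms(2) r, of "1 / r"] by (simp add: one_ereal_def)
  then show ?thesis by (rule that)
qed

lemma apply_le_dual_functional:
  "J v = 1 \<Longrightarrow> ereal (blinfun_apply \<mu> v) \<le> dual_functional J \<mu>"
  unfolding dual_functional_def by (intro SUP_upper) simp

text \<open>As \<open>J v = J (- v) = 1\<close>, the supremum dominates a number and its negative.\<close>

lemma dual_functional_nonneg:
  assumes "abs_one_homogeneous J" and "J v = 1"
  shows "0 \<le> dual_functional J \<mu>"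
proof -
  have minus: "J (- v) = 1"
    using one_homogeneous_scaleR[of J v 1 "-1"] assms by (simp add: one_ereal_def)
  have "0 \<le> ereal \<bar>blinfun_apply \<mu> v\<bar>" by simp
  also have "\<dots> \<le> dual_functional J \<mu>"
    using apply_le_dual_functional[of J v \<mu>] apply_le_dual_functional[of J "- v" \<mu>] assms(2) minus
    by (auto simp: abs_if blinfun.minus_right)
  finally show ?thesis .
qed

lemma dual_functional_le:
  assumes l: "0 < l" and le: "\<And>u. ereal (l * norm u) \<le> J u"
  shows "dual_functional J \<mu> \<le> ereal (norm \<mu> / l)"
  unfolding dual_functional_def
proof (rule SUP_least)
  fix u assume "u \<in> {u. J u = 1}"
  then have "l * norm u \<le> 1" using le[of u] by (simp add: one_ereal_def)
  have "l * blinfun_apply \<mu> u \<le> l * (norm \<mu> * norm u)"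
    using norm_blinfun[of \<mu> u] l by (intro mult_left_mono) auto
  also have "\<dots> = norm \<mu> * (l * norm u)" by simp
  also have "\<dots> \<le> norm \<mu>" using \<open>l * norm u \<le> 1\<close> by (simp add: mult_left_le)
  finally show "ereal (blinfun_apply \<mu> u) \<le> ereal (norm \<mu> / l)"
    using l by (simp add: field_simps)
qed

text \<open>For \<open>l > 0\<close> this is \<open>l J\<^sub>*(\<mu>) \<le> \<parallel>\<mu>\<parallel>\<close> divided by \<open>J\<^sub>*(\<mu>)\<close>, with \<open>\<infinity>\<close> as the quotient when
  \<open>J\<^sub>*(\<mu>) = 0\<close>. For \<open>l \<le> 0\<close>, where \<open>J\<^sub>*(\<mu>) = \<infinity>\<close> can occur, the sign of the quotient suffices.\<close>

lemma le_dual_rayleigh: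
  assumes le: "\<And>u. ereal (l * norm u) \<le> J u"
    and nonneg: "0 \<le> dual_functional J \<mu>" and "\<mu> \<noteq> 0"
  shows "ereal l \<le> dual_rayleigh J \<mu>"
proof (cases "0 < l")
  case False
  have "0 \<le> dual_rayleigh J \<mu>"
    unfolding dual_rayleigh_def using nonneg by (cases "dual_functional J \<mu>") auto
  then show ?thesis using False order_trans[of "ereal l" 0] by simp
next
  case l: True
  then obtain s where s: "dual_functional J \<mu> = ereal s" and "s \<le> norm \<mu> / l" and "0 \<le> s"
    using dual_functional_le[OF l le, of \<mu>] nonneg by (cases "dual_functional J \<mu>") auto
  show ?thesis
  proof (cases "s = 0")
    case True
    then show ?thesis using s assms(3) by (simp add: dual_rayleigh_zero_denominator)
  next
    case False
    then show ?thesis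
      using s l \<open>s \<le> norm \<mu> / l\<close> \<open>0 \<le> s\<close> by (simp add: dual_rayleigh_def field_simps)
  qed
qed

text \<open>The multiple \<open>w\<close> of the minimizer with \<open>J w = 1\<close> has norm \<open>1 / l\<close>, so that \<open>\<langle>\<mu>, w\<rangle>\<close> meets
  the upper bound \<open>\<parallel>\<mu>\<parallel> / l\<close>. The point \<open>w\<close> where the supremum is attained is part of the
  conclusion because the evaluation at \<open>w\<close> is the subgradient of \<open>J\<^sub>*\<close> at \<open>\<mu>\<close> wanted later.\<close>

lemma dual_functional_at_minimizer:
  fixes u :: "'a::real_normed_vector" and l :: real
  defines "w \<equiv> (1 / (l * norm u)) *\<^sub>R u"
  assumes hom: "abs_one_homogeneous J" and l: "0 < l"
    and le: "\<And>z. ereal (l * norm z) \<le> J z"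
    and u: "u \<noteq> 0" "J u = ereal (l * norm u)"
    and mu: "\<mu> \<in> duality_map u"
  shows "J w = 1" and "blinfun_apply \<mu> w = 1 / l"
    and "dual_functional J \<mu> = ereal (1 / l)"
proof -
  show J: "J w = 1"
    using one_homogeneous_scaleR[OF hom u(2), of "1 / (l * norm u)"] l u(1)
    by (simp add: w_def one_ereal_def)
  show app: "blinfun_apply \<mu> w = 1 / l"
    using mu u(1) l by (simp add: w_def duality_map_def blinfun.scaleR_right)
  show "dual_functional J \<mu> = ereal (1 / l)"
    using dual_functional_le[OF l le, of \<mu>] apply_le_dual_functional[of J w \<mu>] J
    by (simp add: app norm_eq_1_of_duality_map[OF u(1) mu])
qed


section \<open>Subgradients\<close>

text \<open>Euler's identity: test the subgradient inequality at \<open>0\<close> and at \<open>2 u\<close>.\<close>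

lemma subdifferential_one_homogeneous:
  assumes hom: "abs_one_homogeneous J" and "J 0 = 0" and "J u \<noteq> -\<infinity>"
    and p: "p \<in> subdifferential J u"
  shows "J u = ereal (blinfun_apply p u)"
proof -
  have sub: "J u + ereal (blinfun_apply p (z - u)) \<le> J z" for z
    using p by (simp add: subdifferential_def)
  obtain r where r: "J u = ereal r"
    using sub[of 0] assms(2,3) by (cases "J u") auto
  have "r \<le> blinfun_apply p u"
    using sub[of 0] r assms(2) by (simp add: blinfun.minus_right)
  moreover have "blinfun_apply p u \<le> r"
    using sub[of "2 *\<^sub>R u"] one_homogeneous_scaleR[OF hom r, of 2] r
    by (simp add: scaleR_2)
  ultimately show ?thesis using r by simp
qed

definition evaluation :: "'a::real_normed_vector \<Rightarrow> ('a \<Rightarrow>\<^sub>L real) \<Rightarrow>\<^sub>L real"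
  where "evaluation w = Blinfun (\<lambda>\<mu>. blinfun_apply \<mu> w)"

lemma evaluation_apply [simp]: "blinfun_apply (evaluation w) \<mu> = blinfun_apply \<mu> w"
  unfolding evaluation_def
  by (simp add: bounded_linear_Blinfun_apply blinfun.bounded_linear_left)

lemma norm_evaluation_le: "norm (evaluation w) \<le> norm w"
proof (rule norm_blinfun_bound)
  show "norm (blinfun_apply (evaluation w) \<mu>) \<le> norm w * norm \<mu>" for \<mu>
    using norm_blinfun[of \<mu> w] by (simp add: mult.commute)
qed simp

lemma evaluation_in_subdifferential:
  assumes "J w = 1" and "dual_functional J \<mu> = ereal (blinfun_apply \<mu> w)"
  shows "evaluation w \<in> subdifferential (dual_functional J) \<mu>"
  using apply_le_dual_functional[of J w] assms
  by (simp add: subdifferential_def blinfun.diff_left)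

lemma evaluation_in_duality_map:
  assumes "u \<noteq> 0" and "\<mu> \<in> duality_map u"
  shows "(1 / norm u) *\<^sub>R evaluation u \<in> duality_map \<mu>"
  using assms norm_evaluation_le[of u] norm_eq_1_of_duality_map[OF assms]
  by (simp add: duality_map_def blinfun.scaleR_left)


section \<open>The ground state and its dual\<close>

theorem proposition1p8:
  fixes J :: "'a::banach \<Rightarrow> ereal"
  assumes "\<And>u. J u \<noteq> -\<infinity>"
    and "convex_functional J"
    and "abs_one_homogeneous J"
    and "effective_domain J \<noteq> {0}"
    and "{u. J u = 0} = {0}"
  shows "(INF u\<in>UNIV - {0}. rayleigh J u) \<le> (INF \<mu>\<in>UNIV - {0}. dual_rayleigh J \<mu>)
    \<and> ((\<exists>u. is_arg_min (rayleigh J) (\<lambda>v. v \<noteq> 0) u) \<longrightarrow>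
         (INF u\<in>UNIV - {0}. rayleigh J u) = (INF \<mu>\<in>UNIV - {0}. dual_rayleigh J \<mu>))
    \<and> (\<forall>l::real. \<forall>u. ereal l = (INF v\<in>UNIV - {0}. rayleigh J v) \<longrightarrow> u \<noteq> 0 \<longrightarrow>
         (\<lambda>\<eta>. l *\<^sub>R \<eta>) ` duality_map u \<inter> subdifferential J u \<noteq> {} \<longrightarrow>
         (\<forall>\<mu>\<in>duality_map u. l *\<^sub>R \<mu> \<in> subdifferential J u \<longrightarrow>
            (\<lambda>\<zeta>. l *\<^sub>R \<zeta>) ` subdifferential (dual_functional J) \<mu> \<inter> duality_map \<mu> \<noteq> {}))"
proof -
  let ?inf = "INF u\<in>UNIV - {0}. rayleigh J u"
  have J0: "J 0 = 0" using assms(5) by blast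
  have nonneg: "0 \<le> J u" for u
    by (rule convex_one_homogeneous_nonneg[OF assms(1-3) J0])
  obtain v where v: "J v = 1" using ex_unit_value[OF nonneg assms(3-5)] .
  obtain l where l: "?inf = ereal l" using inf_rayleigh_real[OF assms] by metis
  have le: "ereal (l * norm u) \<le> J u" for u
  proof (cases "u = 0")
    case False
    then have "ereal l \<le> rayleigh J u" unfolding l[symmetric] by (intro INF_lower) simp
    then show ?thesis using False nonneg[of u]
      by (cases "J u") (auto simp: rayleigh_def field_simps)
  qed (simp add: J0)
  \<comment> \<open>The infimum may be \<open>0\<close>, but it is positive when it is attained, as \<open>J\<close> vanishes only at \<open>0\<close>.\<close>
  have pos: "0 < l" if "u \<noteq> 0" "J u = ereal (l * norm u)" for u
  proof -
    have "J u \<noteq> 0" using assms(5) that(1) by blast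
    then show ?thesis using that nonneg[of u] by (simp add: zero_le_mult_iff less_le)
  qed

  have 1: "?inf \<le> (INF \<mu>\<in>UNIV - {0}. dual_rayleigh J \<mu>)"
    unfolding l
    by (intro INF_greatest le_dual_rayleigh le dual_functional_nonneg[OF assms(3) v]) simp

  have 2: "(INF \<mu>\<in>UNIV - {0}. dual_rayleigh J \<mu>) \<le> ?inf"
    if min: "is_arg_min (rayleigh J) (\<lambda>v. v \<noteq> 0) u" for u
  proof -
    have u: "u \<noteq> 0" using min by (simp add: is_arg_min_def)
    have "rayleigh J u = ?inf"
      using min by (intro antisym INF_greatest INF_lower) (auto simp: is_arg_min_def not_less)
    then have Ju: "J u = ereal (l * norm u)"
      using u assms(1)[of u] unfolding l by (cases "J u") (auto simp: rayleigh_def field_simps)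
    obtain \<mu> where mu: "\<mu> \<in> duality_map u" using duality_map_nonempty[of u] by blast
    have "norm \<mu> = 1" by (rule norm_eq_1_of_duality_map[OF u mu])
    moreover have "dual_functional J \<mu> = ereal (1 / l)"
      by (rule dual_functional_at_minimizer(3)[OF assms(3) pos[OF u Ju] le u Ju mu])
    ultimately have "dual_rayleigh J \<mu> = ereal l" and "\<mu> \<noteq> 0"
      using pos[OF u Ju] by (auto simp: dual_rayleigh_def)
    then show ?thesis unfolding l by (intro INF_lower2[of \<mu>]) auto
  qed

  have 3: "(\<lambda>\<zeta>. l *\<^sub>R \<zeta>) ` subdifferential (dual_functional J) \<mu> \<inter> duality_map \<mu> \<noteq> {}"
    if u: "u \<noteq> 0" and mu: "\<mu> \<in> duality_map u" and sub: "l *\<^sub>R \<mu> \<in> subdifferential J u" for u \<mu>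
  proof -
    have Ju: "J u = ereal (l * norm u)"
      using subdifferential_one_homogeneous[OF assms(3) J0 assms(1) sub] mu
      by (simp add: duality_map_def blinfun.scaleR_left)
    define w where "w = (1 / (l * norm u)) *\<^sub>R u"
    note at_min = dual_functional_at_minimizer[OF assms(3) pos[OF u Ju] le u Ju mu, folded w_def]
    have "evaluation w \<in> subdifferential (dual_functional J) \<mu>"
      using at_min by (intro evaluation_in_subdifferential) auto
    \<comment> \<open>\<open>w\<close> has norm \<open>1 / l\<close>, so the factor \<open>l\<close> turns it into the unit vector along \<open>u\<close>.\<close>
    moreover have "l *\<^sub>R evaluation w = (1 / norm u) *\<^sub>R evaluation u"
      using pos[OF u Ju]
      by (intro blinfun_eqI) (simp add: w_def blinfun.scaleR_left blinfun.scaleR_right)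
    ultimately show ?thesis using evaluation_in_duality_map[OF u mu] by force
  qed

  show ?thesis
  proof (intro conjI allI impI ballI)
    show "?inf \<le> (INF \<mu>\<in>UNIV - {0}. dual_rayleigh J \<mu>)" by (rule 1)
    show "?inf = (INF \<mu>\<in>UNIV - {0}. dual_rayleigh J \<mu>)"
      if "\<exists>u. is_arg_min (rayleigh J) (\<lambda>v. v \<noteq> 0) u"
      using that 1 2 by (metis antisym)
  next
    fix k :: real and u \<mu>
    assume "ereal k = ?inf" and u: "u \<noteq> 0" "\<mu> \<in> duality_map u" "k *\<^sub>R \<mu> \<in> subdifferential J u"
    then have "k = l" using l by simp
    with 3 u
    show "(\<lambda>\<zeta>. k *\<^sub>R \<zeta>) ` subdifferential (dual_functional J) \<mu> \<inter> duality_map \<mu> \<noteq> {}"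
      by blast
  qed
qed

end
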